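(* Let $I$ and $J$ be disjoint non-degenerate intervals contained in $[0,1]$ and let $f,g:[0,1]\to\mathbb{R}$ be such that there is $x_0\in[0,1/2]$ with $f(x_0)=g(x_0)$, and $\lambda(I)+\lambda(J)<1$, where $\lambda$ is Lebesgue measure. If $Q$ is a basic sequence that is infinite in limit, then $$\dim_H\Big\{x\in[0,1):\ f\Big(\lim_{n\to\infty}\frac{A_n(I,\mathcal{O}_Q(x))}{n}\Big)=g\Big(\lim_{n\to\infty}\frac{A_n(J,\mathcal{O}_Q(x))}{n}\Big)\Big\}=1.$$
   Context: A basic sequence is $Q=(q_n)_{n\ge1}$ with integers $q_n\ge2$; infinite in limit means $q_n\to\infty$. $T_{Q,n}(x)=q_n\cdots q_1x\bmod1$ and $\mathcal{O}_Q(x)=(T_{Q,n}(x))_{n\ge0}$. For a sequence $\omega=(x_i)$ and an interval $I$, $A_n(I,\omega)=\#\{i\le n:x_i\in I\}$. The set consists of those $x$ for which both limits exist and the equality holds. *)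

theory Defs
  imports "HOL-Analysis.Analysis"
begin

text \<open>
  The contribution \<open>|U|\<^sup>s\<close> of a covering set, with the conventions that the empty set
  contributes \<open>0\<close> for every \<open>s\<close>, and a nonempty set contributes \<open>1\<close> for \<open>s = 0\<close>. The case
  \<open>s = 0\<close> has to be singled out because \<open>0 powr 0 = 0\<close>.
\<close>

definition hausdorff_gauge :: "real \<Rightarrow> 'a::metric_space set \<Rightarrow> ennreal" where
  "hausdorff_gauge s U =
     (if U = {} then 0 else if s = 0 then 1 else ennreal (diameter U powr s))"

text \<open>
  Boundedness is required explicitly because \<open>diameter\<close> is real-valued and carries no information
  on unbounded sets. Finite covers are included by padding with the empty set.
\<close>

definition delta_covers :: "real \<Rightarrow> 'a::metric_space set \<Rightarrow> (nat \<Rightarrow> 'a set) set" where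
  "delta_covers \<delta> A =
     {U. A \<subseteq> (\<Union>i. U i) \<and> (\<forall>i. bounded (U i) \<and> diameter (U i) \<le> \<delta>)}"

definition hausdorff_pre_measure :: "real \<Rightarrow> real \<Rightarrow> 'a::metric_space set \<Rightarrow> ennreal" where
  "hausdorff_pre_measure s \<delta> A = (INF U\<in>delta_covers \<delta> A. \<Sum>i. hausdorff_gauge s (U i))"

definition hausdorff_measure :: "real \<Rightarrow> 'a::metric_space set \<Rightarrow> ennreal" where
  "hausdorff_measure s A = (SUP \<delta>\<in>{0<..}. hausdorff_pre_measure s \<delta> A)"

definition hausdorff_dim :: "'a::metric_space set \<Rightarrow> ennreal" where
  "hausdorff_dim A = (INF s\<in>{s. 0 \<le> s \<and> hausdorff_measure s A = 0}. ennreal s)"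

text \<open>Basic sequences are indexed from \<open>1\<close>; the value at \<open>0\<close> is irrelevant.\<close>

definition basic_sequence :: "(nat \<Rightarrow> nat) \<Rightarrow> bool" where
  "basic_sequence q \<longleftrightarrow> (\<forall>n\<ge>1. 2 \<le> q n)"

definition infinite_in_limit :: "(nat \<Rightarrow> nat) \<Rightarrow> bool" where
  "infinite_in_limit q \<longleftrightarrow> filterlim q at_top sequentially"

definition cantor_T :: "(nat \<Rightarrow> nat) \<Rightarrow> nat \<Rightarrow> real \<Rightarrow> real" where
  "cantor_T q n x = frac (real (\<Prod>i=1..n. q i) * x)"

definition cantor_orbit :: "(nat \<Rightarrow> nat) \<Rightarrow> real \<Rightarrow> nat \<Rightarrow> real" where
  "cantor_orbit q x = (\<lambda>n. cantor_T q n x)"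

definition visits :: "nat \<Rightarrow> real set \<Rightarrow> (nat \<Rightarrow> real) \<Rightarrow> nat" where
  "visits n I \<omega> = card {i. i \<le> n \<and> \<omega> i \<in> I}"

definition nondegenerate_interval :: "real set \<Rightarrow> bool" where
  "nondegenerate_interval I \<longleftrightarrow> is_interval I \<and> (\<exists>a\<in>I. \<exists>b\<in>I. a < b)"

end

theory Submission
  imports Defs
begin

text \<open>
  Fix \<open>p \<le> 1/2\<close> with \<open>f p = g p\<close>. The times \<open>n\<close> at which \<open>(n p, (n + 1) p]\<close> contains an integer,
  respectively a half-integer, form disjoint sets of density \<open>p\<close>. Force the orbit of \<open>x\<close> into a
  compact part of \<open>I\<close> at times of the first kind, of \<open>J\<close> at times of the second kind, and of the
  complement of \<open>I \<union> J\<close> otherwise. Each constraint leaves a block of \<open>m\<^sub>n \<ge> c q\<^sub>n\<close> consecutive digits.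
  Since \<open>q\<^sub>n \<rightarrow> \<infinity>\<close>, the product of the \<open>m\<^sub>n\<close> dominates every power \<open>s < 1\<close> of the product of the
  \<open>q\<^sub>n\<close>, so reading the digits of such \<open>x\<close> in base \<open>m\<close> is an \<open>s\<close>-Hoelder map onto \<open>[0,1)\<close>, whence the
  constrained set has positive \<open>s\<close>-dimensional measure.
\<close>

section \<open>Hausdorff measure on the line\<close>

text \<open>At exponent 0 every nonempty covering set costs 1, so a cover of total cost below 1
  consists of empty sets. This excludes the exponent 0 from the infimum that defines the
  dimension.\<close>

lemma hausdorff_measure_0_eq_0:
  assumes "hausdorff_measure 0 A = 0"
  shows "A = {}"
proof -
  have "hausdorff_pre_measure 0 1 A \<le> hausdorff_measure 0 A"
    unfolding hausdorff_measure_def by (rule SUP_upper) simp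
  then have "hausdorff_pre_measure 0 1 A < 1" using assms by simp
  then obtain U where U: "U \<in> delta_covers 1 A" "(\<Sum>i. hausdorff_gauge 0 (U i)) < 1"
    unfolding hausdorff_pre_measure_def by (auto simp: INF_less_iff)
  have "U i = {}" for i
  proof (rule ccontr)
    assume "U i \<noteq> {}"
    then have "hausdorff_gauge 0 (U i) = 1" by (simp add: hausdorff_gauge_def)
    moreover have "sum (\<lambda>i. hausdorff_gauge 0 (U i)) {i} \<le> (\<Sum>i. hausdorff_gauge 0 (U i))"
      by (rule sum_le_suminf) auto
    ultimately show False using U(2) by simp
  qed
  then show ?thesis using U(1) by (auto simp: delta_covers_def)
qed

text \<open>The inverse of \<open>\<psi>\<close> is \<open>s\<close>-Hoelder onto the unit interval.
  A cover of \<open>E\<close> thus pulls back to a cover of \<open>{0..<1}\<close> by intervals of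
  length a constant times \<open>diameter (U i) powr s\<close>, and these lengths must add up to at
  least 1.\<close>

lemma hausdorff_measure_pos_of_expanding:
  fixes \<psi> :: "real \<Rightarrow> 'a::metric_space"
  assumes s: "0 < s" and sub: "\<psi> ` {0..<1} \<subseteq> E"
    and exp: "\<And>t t'. t \<in> {0..<1} \<Longrightarrow> t' \<in> {0..<1} \<Longrightarrow>
      \<bar>t - t'\<bar> \<le> C * dist (\<psi> t) (\<psi> t') powr s"
  shows "hausdorff_measure s E \<noteq> 0"
proof
  assume "hausdorff_measure s E = 0"
  \<comment> \<open>\<open>C\<close> is not assumed positive; enlarging it makes division by it
    safe.\<close>
  define B where "B = max C 1"
  have B: "B > 0" "C \<le> B" by (auto simp: B_def)
  have "hausdorff_pre_measure s 1 E \<le> hausdorff_measure s E"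
    unfolding hausdorff_measure_def by (rule SUP_upper) simp
  then have "hausdorff_pre_measure s 1 E < ennreal (1 / (2 * B))"
    using \<open>hausdorff_measure s E = 0\<close> B by simp
  then obtain U where U: "U \<in> delta_covers 1 E"
    "(\<Sum>i. hausdorff_gauge s (U i)) < ennreal (1 / (2 * B))"
    unfolding hausdorff_pre_measure_def by (auto simp: INF_less_iff)
  define V where "V i = {t \<in> {0..<1}. \<psi> t \<in> U i}" for i
  \<comment> \<open>Any centre in \<open>V i\<close> will do. If \<open>V i\<close> is empty, the
    choice is arbitrary and the inclusion in \<open>W i\<close> is trivial.\<close>
  define p where "p i = (SOME t. t \<in> V i)" for i
  define \<rho> where "\<rho> i = B * diameter (U i) powr s" for i
  define W where "W i = (if U i = {} then {} else {p i - \<rho> i..p i + \<rho> i})" for i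
  have V_W: "V i \<subseteq> W i" for i
  proof
    fix t assume t: "t \<in> V i"
    then have p: "p i \<in> V i" unfolding p_def by (rule someI)
    have "dist (\<psi> (p i)) (\<psi> t) \<le> diameter (U i)"
      using t p U(1) by (intro diameter_bounded_bound) (auto simp: V_def delta_covers_def)
    then have "dist (\<psi> (p i)) (\<psi> t) powr s \<le> diameter (U i) powr s"
      using s by (intro powr_mono2) auto
    moreover have "\<bar>p i - t\<bar> \<le> C * dist (\<psi> (p i)) (\<psi> t) powr s"
      using t p by (intro exp) (auto simp: V_def)
    moreover have "C * dist (\<psi> (p i)) (\<psi> t) powr s \<le> B * dist (\<psi> (p i)) (\<psi> t) powr s"
      using B by (intro mult_right_mono) auto
    ultimately have "\<bar>p i - t\<bar> \<le> \<rho> i"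
      unfolding \<rho>_def using B by (smt (verit) mult_left_mono)
    then show "t \<in> W i" using t by (auto simp: W_def V_def)
  qed
  have cover: "{0..<1} \<subseteq> (\<Union>i. W i)"
  proof
    fix t :: real assume t: "t \<in> {0..<1}"
    then have "\<psi> t \<in> E" using sub by auto
    then have "\<psi> t \<in> (\<Union>i. U i)" using U(1) unfolding delta_covers_def by blast
    then show "t \<in> (\<Union>i. W i)" using t V_W by (auto simp: V_def)
  qed
  have [measurable]: "W i \<in> sets borel" for i by (simp add: W_def)
  have W_le: "emeasure lborel (W i) \<le> ennreal (2 * B) * hausdorff_gauge s (U i)" for i
    using B s by (auto simp: W_def hausdorff_gauge_def \<rho>_def ennreal_mult[symmetric])
  have "1 = emeasure lborel {0..<1::real}" by simp
  also have "\<dots> \<le> emeasure lborel (\<Union>i. W i)" using cover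
    by (intro emeasure_mono sets.countable_UN) (auto simp: W_def)
  also have "\<dots> \<le> (\<Sum>i. emeasure lborel (W i))" by (rule emeasure_subadditive_countably) auto
  also have "\<dots> \<le> (\<Sum>i. ennreal (2 * B) * hausdorff_gauge s (U i))"
    by (intro suminf_le W_le) auto
  also have "\<dots> = ennreal (2 * B) * (\<Sum>i. hausdorff_gauge s (U i))" by simp
  also have "\<dots> < ennreal (2 * B) * ennreal (1 / (2 * B))"
    using U(2) B by (intro ennreal_mult_strict_left_mono) auto
  also have "\<dots> = 1" using B by (simp add: ennreal_mult[symmetric])
  finally show False by simp
qed

text \<open>The \<open>n\<close> intervals of length \<open>1 / n\<close> cost
  \<open>n powr (1 - s)\<close> in total, which tends to 0.\<close>

lemma hausdorff_measure_unit_interval_eq_0: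
  assumes s: "1 < s" and A: "A \<subseteq> {0..<1::real}"
  shows "hausdorff_measure s A = 0"
proof -
  have "hausdorff_pre_measure s \<delta> A \<le> 0" if \<delta>: "0 < \<delta>" for \<delta>
  proof (rule LIMSEQ_le_const)
    have "(\<lambda>n. real n powr (1 - s)) \<longlonglongrightarrow> 0"
      using s by (intro tendsto_neg_powr filterlim_real_sequentially) auto
    from tendsto_ennrealI[OF this]
    show "(\<lambda>n. ennreal (real n powr (1 - s))) \<longlonglongrightarrow> 0" by simp
    obtain N :: nat where N: "1 / \<delta> < real N" using reals_Archimedean2 by blast
    show "\<exists>N. \<forall>n\<ge>N. hausdorff_pre_measure s \<delta> A \<le> ennreal (real n powr (1 - s))"
    proof (intro exI[of _ "max N 1"] allI impI)
      fix n assume n: "max N 1 \<le> n"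
      then have n1: "real n \<ge> 1" and "1 / \<delta> < real n" using N by auto
      then have n\<delta>: "1 / real n \<le> \<delta>" using \<delta> by (simp add: field_simps)
      define U where "U i = (if i < n then {real i / real n..(real i + 1) / real n} else {})" for i
      have diam: "diameter (U i) = 1 / real n" if "i < n" for i
        using that n1 by (simp add: U_def divide_less_cancel diff_divide_distrib[symmetric])
      have "A \<subseteq> (\<Union>i. U i)"
      proof
        fix x assume "x \<in> A"
        then have x: "0 \<le> x" "x < 1" using A by auto
        define i where "i = nat \<lfloor>real n * x\<rfloor>"
        have i: "real i = of_int \<lfloor>real n * x\<rfloor>" using x by (simp add: i_def)
        have "real i \<le> real n * x" "real n * x < real i + 1" unfolding i by linarith+
        moreover have "real n * x < real n" using x n1 by simp
        ultimately have "i < n" "x \<in> {real i / real n..(real i + 1) / real n}"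
          using n1 by (linarith, simp add: field_simps)
        then show "x \<in> (\<Union>i. U i)" by (auto simp: U_def)
      qed
      moreover have "bounded (U i) \<and> diameter (U i) \<le> \<delta>" for i
        using diam[of i] n\<delta> \<delta> by (cases "i < n") (auto simp: U_def)
      ultimately have "U \<in> delta_covers \<delta> A" by (auto simp: delta_covers_def)
      then have "hausdorff_pre_measure s \<delta> A \<le> (\<Sum>i. hausdorff_gauge s (U i))"
        unfolding hausdorff_pre_measure_def by (rule INF_lower)
      also have "\<dots> = (\<Sum>i<n. hausdorff_gauge s (U i))"
        by (rule suminf_finite) (auto simp: U_def hausdorff_gauge_def)
      also have "\<dots> \<le> (\<Sum>i<n. ennreal ((1 / real n) powr s))"
        using s by (intro sum_mono) (auto simp: hausdorff_gauge_def diam)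
      also have "\<dots> = ennreal (real n * (1 / real n) powr s)"
        by (simp add: ennreal_mult ennreal_of_nat_eq_real_of_nat)
      also have "real n * (1 / real n) powr s = real n powr (1 - s)"
        using n1 by (simp add: powr_divide powr_diff)
      finally show "hausdorff_pre_measure s \<delta> A \<le> ennreal (real n powr (1 - s))" .
    qed
  qed
  then show ?thesis unfolding hausdorff_measure_def
    by (intro antisym SUP_least) auto
qed

lemma hausdorff_dim_eq_1I:
  fixes A :: "real set"
  assumes A: "A \<subseteq> {0..<1}" "A \<noteq> {}"
    and pos: "\<And>s. 0 < s \<Longrightarrow> s < 1 \<Longrightarrow> hausdorff_measure s A \<noteq> 0"
  shows "hausdorff_dim A = 1"
proof (rule antisym)
  show "1 \<le> hausdorff_dim A" unfolding hausdorff_dim_def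
  proof (rule INF_greatest)
    fix s assume s: "s \<in> {s. 0 \<le> s \<and> hausdorff_measure s A = 0}"
    then have "s \<noteq> 0" using A(2) hausdorff_measure_0_eq_0[of A] by auto
    with s pos[of s] have "1 \<le> s" by force
    then show "1 \<le> ennreal s" by simp
  qed
  show "hausdorff_dim A \<le> 1"
  proof (rule ennreal_le_epsilon)
    fix e :: real assume "0 < e"
    then have "hausdorff_dim A \<le> ennreal (1 + e)" unfolding hausdorff_dim_def
      using hausdorff_measure_unit_interval_eq_0[OF _ A(1), of "1 + e"]
      by (intro INF_lower) auto
    then show "hausdorff_dim A \<le> 1 + ennreal e" using \<open>0 < e\<close> by simp
  qed
qed

section \<open>Cantor series\<close>

text \<open>The Cantor series formed by the digits from position \<open>n\<close> on, with base
  entries indexed from 0.\<close>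

definition series_tail :: "(nat \<Rightarrow> nat) \<Rightarrow> (nat \<Rightarrow> nat) \<Rightarrow> nat \<Rightarrow> real" where
  "series_tail r D n = (\<Sum>i. real (D (n + i)) / (\<Prod>l\<le>i. real (r (n + l))))"

text \<open>Since \<open>D n\<close> is at most \<open>r n - 1\<close>, each term is bounded by a
  difference of consecutive reciprocal products. The partial sums telescope to at most 1, which
  gives summability; the recursion splits off the first term.\<close>

lemma
  assumes D: "\<And>n. D n < r n"
  shows series_tail_nonneg: "0 \<le> series_tail r D n"
    and series_tail_le_1: "series_tail r D n \<le> 1"
    and series_tail_rec: "series_tail r D n = (real (D n) + series_tail r D (Suc n)) / real (r n)"
proof -
  define F where "F n i = real (D (n + i)) / (\<Prod>l\<le>i. real (r (n + l)))" for n i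
  have r: "0 < real (r n)" for n using D[of n] by simp
  have F0: "0 \<le> F n i" for n i by (auto simp: F_def intro!: divide_nonneg_nonneg prod_nonneg)
  have part: "(\<Sum>i<k. F n i) \<le> 1 - 1 / (\<Prod>l<k. real (r (n + l)))" for n k
  proof (induction k)
    case (Suc k)
    define P where "P = (\<Prod>l<k. real (r (n + l)))"
    have P: "P > 0" unfolding P_def by (intro prod_pos) (use r in blast)
    have "real (D (n + k)) \<le> real (r (n + k)) - 1" using D[of "n + k"] by linarith
    then have "F n k \<le> (real (r (n + k)) - 1) / (P * real (r (n + k)))"
      unfolding F_def P_def lessThan_Suc_atMost[symmetric] prod.lessThan_Suc
      using P r by (intro divide_right_mono) (auto simp: P_def less_imp_le)
    also have "\<dots> = 1 / P - 1 / (P * real (r (n + k)))"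
      using P r[of "n + k"] by (simp add: field_simps)
    finally show ?case using Suc by (simp add: P_def)
  qed simp
  have part1: "(\<Sum>i<k. F n i) \<le> 1" for n k
  proof -
    have "0 \<le> 1 / (\<Prod>l<k. real (r (n + l)))" by (auto intro!: divide_nonneg_nonneg prod_nonneg)
    then show ?thesis using part[of n k] by linarith
  qed
  have sm: "summable (F n)" for n by (rule summableI_nonneg_bounded[OF F0 part1])
  have tail: "series_tail r D n = suminf (F n)" for n by (simp add: series_tail_def F_def[abs_def])
  show "0 \<le> series_tail r D n" unfolding tail by (intro suminf_nonneg sm F0)
  show "series_tail r D n \<le> 1" unfolding tail by (intro suminf_le_const sm part1)
  have "F n (Suc i) = F (Suc n) i / real (r n)" for i
    unfolding F_def prod.atMost_Suc_shift by simp
  then have "(\<Sum>i. F n (Suc i)) = suminf (F (Suc n)) / real (r n)"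
    using suminf_divide[OF sm[of "Suc n"]] by simp
  then show "series_tail r D n = (real (D n) + series_tail r D (Suc n)) / real (r n)"
    unfolding tail using suminf_split_head[OF sm[of n]] by (simp add: F_def add_divide_distrib)
qed

text \<open>Multiplying by \<open>r n\<close> moves one digit into the integer part. Tails equal to
  1, which arise from maximal digits throughout, have to be excluded because their fractional part
  is 0.\<close>

lemma frac_prod_times_series_tail:
  assumes D: "\<And>n. D n < r n" and lt: "\<And>n. series_tail r D n < 1"
  shows "frac (real (\<Prod>i<n. r i) * series_tail r D 0) = series_tail r D n"
proof -
  have "\<exists>z::int. real (\<Prod>i<n. r i) * series_tail r D 0 = of_int z + series_tail r D n"
  proof (induction n)
    case 0
    show ?case by (rule exI[of _ 0]) simp
  next
    case (Suc n)
    then obtain z :: int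
      where z: "real (\<Prod>i<n. r i) * series_tail r D 0 = of_int z + series_tail r D n" by blast
    have "real (\<Prod>i<Suc n. r i) * series_tail r D 0
        = real (r n) * (real (\<Prod>i<n. r i) * series_tail r D 0)"
      by (simp add: mult_ac)
    also have "\<dots> = real (r n) * (of_int z + series_tail r D n)" unfolding z ..
    also have "\<dots> = of_int (int (r n) * z + int (D n)) + series_tail r D (Suc n)"
      using D[of n] series_tail_rec[of D r n, OF D] by (simp add: field_simps)
    finally show ?case by blast
  qed
  then obtain z :: int
    where "real (\<Prod>i<n. r i) * series_tail r D 0 = of_int z + series_tail r D n" by blast
  moreover have "frac (series_tail r D n) = series_tail r D n"
    using series_tail_nonneg[OF D] lt by (simp add: frac_eq)
  ultimately show ?thesis by (simp add: add.commute frac_def)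
qed

section \<open>Digits of a given point\<close>

primrec cantor_rem :: "(nat \<Rightarrow> nat) \<Rightarrow> real \<Rightarrow> nat \<Rightarrow> real" where
  "cantor_rem m t 0 = t"
| "cantor_rem m t (Suc n) = frac (real (m n) * cantor_rem m t n)"

text \<open>Base entries equal to 1 are admissible: for \<open>t\<close> in \<open>{0..<1}\<close>
  the digit there is 0 and the remainder is unchanged.\<close>

definition cantor_digit :: "(nat \<Rightarrow> nat) \<Rightarrow> real \<Rightarrow> nat \<Rightarrow> nat" where
  "cantor_digit m t n = nat \<lfloor>real (m n) * cantor_rem m t n\<rfloor>"

lemma
  assumes "t \<in> {0..<1}"
  shows cantor_rem_nonneg: "0 \<le> cantor_rem m t n"
    and cantor_rem_less_1: "cantor_rem m t n < 1"
  using assms by (cases n; simp add: frac_lt_1)+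

lemma cantor_rem_rec:
  assumes "t \<in> {0..<1}" "0 < m n"
  shows "cantor_rem m t n = (real (cantor_digit m t n) + cantor_rem m t (Suc n)) / real (m n)"
  using assms cantor_rem_nonneg[OF assms(1), of m n]
  by (simp add: cantor_digit_def frac_def)

lemma cantor_digit_less:
  assumes "t \<in> {0..<1}" "0 < m n"
  shows "cantor_digit m t n < m n"
proof -
  have "real (m n) * cantor_rem m t n < real (m n)"
    using cantor_rem_less_1[OF assms(1), of m n] assms(2) by simp
  then have "\<lfloor>real (m n) * cantor_rem m t n\<rfloor> < int (m n)" by linarith
  then show ?thesis using assms(2) by (simp add: cantor_digit_def)
qed

text \<open>Equal digits cancel in the recursion, so each one only divides the difference by its
  base entry. This serves both the remainders in base \<open>m\<close> and the tails in base
  \<open>r\<close>.\<close>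

lemma diff_of_common_digits:
  fixes Z Z' :: "nat \<Rightarrow> real"
  assumes "\<And>n. Z n = (D n + Z (Suc n)) / b n" "\<And>n. Z' n = (D' n + Z' (Suc n)) / b n"
    and "\<And>n. n < k \<Longrightarrow> D n = D' n"
  shows "Z 0 - Z' 0 = (Z k - Z' k) / (\<Prod>i<k. b i)"
  using assms(3)
proof (induction k)
  case (Suc k)
  have "Z k - Z' k = (Z (Suc k) - Z' (Suc k)) / b k"
    using assms(1)[of k] assms(2)[of k] Suc.prems[of k] by (simp add: diff_divide_distrib[symmetric])
  then show ?case using Suc by (simp add: mult.commute)
qed simp

definition recode :: "(nat \<Rightarrow> nat) \<Rightarrow> (nat \<Rightarrow> nat) \<Rightarrow> real \<Rightarrow> nat \<Rightarrow> nat" where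
  "recode m d t n = d n + cantor_digit m t n"

text \<open>Reading off the digits of \<open>t\<close> in base \<open>m\<close> and writing them, shifted by \<open>d\<close>, in base \<open>r\<close>
  inverts a Hoelder map. The parameter \<open>\<delta>\<close> keeps the tails away from \<open>0\<close> and \<open>1\<close>, so that even
  points of neighbouring cylinders are separated by a multiple of the cylinder length.\<close>

lemma recode_expanding:
  fixes r m d :: "nat \<Rightarrow> nat"
  assumes m: "\<And>n. 0 < m n" and fit: "\<And>n. d n + m n \<le> r n" and r2: "\<And>n. 2 \<le> r n"
    and s: "0 < s" "s < 1" and \<delta>: "0 < \<delta>" "\<delta> \<le> 1/2"
    and frozen: "\<And>n. n < N \<Longrightarrow> m n = 1"
    and low: "\<And>n. N \<le> n \<Longrightarrow> \<delta> * real (r n) \<le> real (d n)"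
    and high: "\<And>n. N \<le> n \<Longrightarrow> real (d n + m n) \<le> (1 - \<delta>) * real (r n)"
    and c: "0 < c" "\<And>n. N \<le> n \<Longrightarrow> c * real (r n) \<le> real (m n)"
    and C: "\<And>k. (\<Prod>i<k. real (r i)) powr s \<le> C * (\<Prod>i<k. real (m i))"
    and t: "t \<in> {0..<1}" and t': "t' \<in> {0..<1}"
  shows "\<bar>t - t'\<bar> \<le> (2 * C / (2 * \<delta> * c) powr s) *
    \<bar>series_tail r (recode m d t) 0 - series_tail r (recode m d t') 0\<bar> powr s"
proof -
  define X where "X = series_tail r (recode m d t)"
  define X' where "X' = series_tail r (recode m d t')"
  define Y where "Y = cantor_rem m t"
  define Y' where "Y' = cantor_rem m t'"
  define e where "e = cantor_digit m t"
  define e' where "e' = cantor_digit m t'"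
  define P where "P k = (\<Prod>i<k. real (r i))" for k
  define M where "M k = (\<Prod>i<k. real (m i))" for k
  have r0: "0 < real (r n)" for n using r2[of n] by simp
  have P0: "0 < P k" for k unfolding P_def by (intro prod_pos) (use r0 in blast)
  have M0: "0 < M k" for k unfolding M_def by (intro prod_pos) (simp add: m)
  have C0: "C > 0" using C[of 0] by simp
  have MP: "1 / M k \<le> C / P k powr s" for k
    using C[of k] M0[of k] P0[of k] unfolding P_def[symmetric] M_def[symmetric]
    by (simp add: field_simps)
  have em: "e n < m n" "e' n < m n" for n
    unfolding e_def e'_def using cantor_digit_less t t' m by auto
  have rec_less: "recode m d t n < r n" "recode m d t' n < r n" for n
    using em[of n] fit[of n] by (auto simp: recode_def e_def e'_def)
  have X_rec: "X n = (real (d n + e n) + X (Suc n)) / real (r n)"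
    and X'_rec: "X' n = (real (d n + e' n) + X' (Suc n)) / real (r n)" for n
    unfolding X_def X'_def e_def e'_def
    using series_tail_rec[of "recode m d t" r n] series_tail_rec[of "recode m d t'" r n] rec_less
    by (simp_all add: recode_def)
  have Y_rec: "Y n = (real (e n) + Y (Suc n)) / real (m n)"
    and Y'_rec: "Y' n = (real (e' n) + Y' (Suc n)) / real (m n)" for n
    unfolding Y_def Y'_def e_def e'_def using cantor_rem_rec t t' m by auto
  have Y01: "0 \<le> Y n" "Y n < 1" "0 \<le> Y' n" "Y' n < 1" for n
    unfolding Y_def Y'_def using cantor_rem_nonneg cantor_rem_less_1 t t' by auto
  have X01: "0 \<le> X n" "X n \<le> 1" "0 \<le> X' n" "X' n \<le> 1" for n
    unfolding X_def X'_def
    using series_tail_nonneg[of "recode m d t" r n] series_tail_nonneg[of "recode m d t'" r n]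
      series_tail_le_1[of "recode m d t" r n] series_tail_le_1[of "recode m d t'" r n] rec_less by auto
  \<comment> \<open>Admissible digits keep both tails in an interval of length
    \<open>1 - 2 * \<delta>\<close>, so two tails never differ by as much as a full digit.\<close>
  have gap: "\<delta> \<le> X n \<and> X n \<le> 1 - \<delta> \<and> \<delta> \<le> X' n \<and> X' n \<le> 1 - \<delta>" if n: "N \<le> n" for n
  proof -
    have "real (e n) + 1 \<le> real (m n)" "real (e' n) + 1 \<le> real (m n)"
      using em[of n] by linarith+
    then show ?thesis
      unfolding X_rec[of n] X'_rec[of n]
      using low[OF n] high[OF n] r0[of n] X01[of "Suc n"] by (simp add: field_simps)
  qed
  show ?thesis
  proof (cases "\<forall>n. e n = e' n")
    \<comment> \<open>If all digits agree, then \<open>t = t'\<close>: the base \<open>m\<close>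
      cylinders shrink, as their lengths are at most \<open>C / P k powr s\<close> and
      \<open>P k\<close> is at least \<open>2 ^ k\<close>.\<close>
    case True
    have "\<bar>t - t'\<bar> \<le> C * (1 / 2 powr s) ^ k" for k
    proof -
      have "Y 0 - Y' 0 = (Y k - Y' k) / M k"
        unfolding M_def by (rule diff_of_common_digits[where D = "\<lambda>n. real (e n)" and D' = "\<lambda>n. real (e' n)",
            OF Y_rec Y'_rec]) (simp add: True)
      then have "\<bar>t - t'\<bar> = \<bar>Y k - Y' k\<bar> / M k"
        using M0[of k] by (simp add: Y_def Y'_def)
      also have "\<dots> \<le> 1 / M k"
        using Y01[of k] M0[of k] by (intro divide_right_mono) auto
      also have "\<dots> \<le> C / P k powr s"
        by (rule MP)
      also have "\<dots> \<le> C / (2 ^ k) powr s"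
      proof -
        have "(\<Prod>i<k. (2::real)) \<le> P k" unfolding P_def
          using r2 by (intro prod_mono) (simp add: numeral_le_real_of_nat_iff)
        then have "(2 ^ k) powr s \<le> P k powr s" using s by (intro powr_mono2) auto
        then show ?thesis using C0 by (intro divide_left_mono) (use P0[of k] in auto)
      qed
      also have "\<dots> = C * (1 / 2 powr s) ^ k"
        by (simp add: powr_power powr_realpow[symmetric] powr_powr power_divide mult.commute)
      finally show ?thesis .
    qed
    moreover have "(\<lambda>k. C * (1 / 2 powr s) ^ k) \<longlonglongrightarrow> C * 0"
      using s by (intro tendsto_mult tendsto_const LIMSEQ_power_zero) simp
    ultimately have "\<bar>t - t'\<bar> \<le> C * 0" by (intro LIMSEQ_le_const) auto
    then show ?thesis using C0 by simp
  next
    case False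
    define k where "k = (LEAST n. e n \<noteq> e' n)"
    have k: "e k \<noteq> e' k" unfolding k_def using False by (metis (mono_tags, lifting) LeastI)
    have lk: "e n = e' n" if "n < k" for n using that not_less_Least unfolding k_def by blast
    \<comment> \<open>A frozen position only has the digit 0, so the first difference occurs at a
      free one.\<close>
    have kN: "N \<le> k"
    proof (rule ccontr)
      assume "\<not> N \<le> k"
      then have "m k = 1" by (intro frozen) simp
      then show False using em[of k] k by simp
    qed
    define u where "u = real (e k) - real (e' k)"
    define j where "j = \<bar>u\<bar>"
    have j1: "1 \<le> j" using k unfolding j_def u_def by linarith
    have jm: "j \<le> real (m k)" using em[of k] unfolding j_def u_def by linarith
    have "Y 0 - Y' 0 = (Y k - Y' k) / M k"
      unfolding M_def by (rule diff_of_common_digits[where D = "\<lambda>n. real (e n)" and D' = "\<lambda>n. real (e' n)",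
            OF Y_rec Y'_rec]) (simp add: lk)
    then have "\<bar>t - t'\<bar> = \<bar>Y k - Y' k\<bar> / M k" using M0[of k] by (simp add: Y_def Y'_def)
    also have "\<bar>Y k - Y' k\<bar> = \<bar>u + (Y (Suc k) - Y' (Suc k))\<bar> / real (m k)"
      unfolding Y_rec[of k] Y'_rec[of k] u_def
      by (simp add: diff_divide_distrib[symmetric] abs_divide algebra_simps)
    also have "\<dots> \<le> (2 * j) / real (m k)"
    proof (rule divide_right_mono)
      have "\<bar>Y (Suc k) - Y' (Suc k)\<bar> \<le> 1" using Y01[of "Suc k"] by linarith
      then show "\<bar>u + (Y (Suc k) - Y' (Suc k))\<bar> \<le> 2 * j"
        using j1 unfolding j_def by linarith
    qed simp
    finally have tt: "\<bar>t - t'\<bar> \<le> 2 * j / real (m k) / M k"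
      using M0[of k] by (simp add: divide_right_mono)
    have "X 0 - X' 0 = (X k - X' k) / P k"
      unfolding P_def by (rule diff_of_common_digits[where D = "\<lambda>n. real (d n + e n)"
            and D' = "\<lambda>n. real (d n + e' n)", OF X_rec X'_rec]) (simp add: lk)
    then have "\<bar>X 0 - X' 0\<bar> = \<bar>X k - X' k\<bar> / P k" using P0[of k] by simp
    also have "\<bar>X k - X' k\<bar> = \<bar>u + (X (Suc k) - X' (Suc k))\<bar> / real (r k)"
      unfolding X_rec[of k] X'_rec[of k] u_def
      by (simp add: diff_divide_distrib[symmetric] abs_divide algebra_simps)
    finally have xx0: "\<bar>X 0 - X' 0\<bar>
      = \<bar>u + (X (Suc k) - X' (Suc k))\<bar> / real (r k) / P k" .
    \<comment> \<open>As \<open>j\<close> is at least 1, the digit difference outweighs that of the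
      tails even for adjacent digits.\<close>
    have "2 * \<delta> * j \<le> j - (1 - 2 * \<delta>)"
      using mult_right_mono[of 1 j "1 - 2 * \<delta>"] j1 \<delta> by (simp add: algebra_simps)
    also have "\<dots> \<le> \<bar>u + (X (Suc k) - X' (Suc k))\<bar>"
      using gap[of "Suc k"] kN unfolding j_def by linarith
    finally have "2 * \<delta> * j / real (r k) / P k \<le> \<bar>X 0 - X' 0\<bar>"
      unfolding xx0 using r0[of k] P0[of k] by (intro divide_right_mono) auto
    then have xx: "(2 * \<delta> * j / real (r k) / P k) powr s \<le> \<bar>X 0 - X' 0\<bar> powr s"
      using s j1 \<delta> r0[of k] P0[of k] by (intro powr_mono2) auto
    \<comment> \<open>Since \<open>j / m k\<close> is at most 1 and \<open>s < 1\<close>, it is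
      bounded by its own \<open>s\<close>-th power; \<open>c\<close> then replaces
      \<open>m k\<close> by \<open>r k\<close>.\<close>
    have ml: "real (m k) = real (m k) powr s * real (m k) powr (1 - s)"
      using m[of k] by (simp add: powr_add[symmetric])
    have jl: "j = j powr s * j powr (1 - s)" using j1 by (simp add: powr_add[symmetric])
    have "j powr (1 - s) \<le> real (m k) powr (1 - s)" using j1 jm s by (intro powr_mono2) auto
    then have "j / real (m k) \<le> j powr s / real (m k) powr s"
      using m[of k] j1 by (subst ml, subst (1) jl) (simp add: divide_simps mult_left_mono)
    also have "\<dots> \<le> j powr s / (c * real (r k)) powr s"
      using c(1) c(2)[OF kN] r0[of k] s m[of k] j1
      by (intro divide_left_mono powr_mono2 mult_pos_pos) auto
    finally have jm': "j / real (m k) \<le> j powr s / (c * real (r k)) powr s" .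
    have "2 * (j / real (m k)) * (1 / M k)
        \<le> 2 * (j powr s / (c * real (r k)) powr s) * (C / P k powr s)"
      using jm' MP[of k] M0[of k] j1 by (intro mult_mono) auto
    also have "\<dots> = (2 * C / (2 * \<delta> * c) powr s) * (2 * \<delta> * j / real (r k) / P k) powr s"
      using c \<delta> j1 r0[of k] P0[of k] by (simp add: powr_mult powr_divide field_simps)
    also have "\<dots> \<le> (2 * C / (2 * \<delta> * c) powr s) * \<bar>X 0 - X' 0\<bar> powr s"
      using xx C0 by (intro mult_left_mono) auto
    finally show ?thesis using tt by (simp add: X_def X'_def)
  qed
qed

section \<open>Prescribed visits\<close>

text \<open>As \<open>r n\<close> tends to infinity and \<open>s < 1\<close>, eventually
  \<open>r n powr s\<close> is at most \<open>c * r n\<close>, hence at most \<open>m n\<close>.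
  From then on the quotient of the two products does not increase, so its maximum over an initial
  segment bounds it.\<close>

lemma prod_powr_bounded:
  fixes r m :: "nat \<Rightarrow> nat"
  assumes r: "filterlim r at_top sequentially" "\<And>n. 0 < r n" and m: "\<And>n. 0 < m n"
    and c: "0 < c" "\<And>n. N \<le> n \<Longrightarrow> c * real (r n) \<le> real (m n)" and s: "s < 1"
  obtains C where "\<And>k. (\<Prod>i<k. real (r i)) powr s \<le> C * (\<Prod>i<k. real (m i))"
proof -
  define M where "M k = (\<Prod>i<k. real (m i))" for k
  define u where "u k = (\<Prod>i<k. real (r i)) powr s / M k" for k
  have M0: "0 < M k" for k unfolding M_def by (intro prod_pos) (simp add: m)
  have "(\<lambda>n. real (r n) powr (s - 1)) \<longlonglongrightarrow> 0"
    using s by (intro tendsto_neg_powr filterlim_compose[OF filterlim_real_sequentially r(1)]) simp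
  then have "eventually (\<lambda>n. real (r n) powr (s - 1) < c) sequentially"
    using c(1) by (rule order_tendstoD)
  then obtain K where K: "\<And>n. K \<le> n \<Longrightarrow> real (r n) powr (s - 1) < c"
    by (auto simp: eventually_sequentially)
  define L where "L = max K N"
  have dec: "u (Suc k) \<le> u k" if "L \<le> k" for k
  proof -
    have "real (r k) powr s / real (r k) < c"
      using K[of k] that r(2)[of k] by (simp add: L_def powr_diff)
    then have "real (r k) powr s \<le> c * real (r k)"
      using r(2)[of k] by (simp add: field_simps)
    also have "\<dots> \<le> real (m k)" using c(2) that by (simp add: L_def)
    finally have "real (r k) powr s / real (m k) \<le> 1" using m[of k] by simp
    moreover have "u (Suc k) = u k * (real (r k) powr s / real (m k))"
      by (simp add: u_def M_def powr_mult prod_nonneg)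
    moreover have "0 \<le> u k" using M0[of k] by (simp add: u_def)
    ultimately show ?thesis using mult_left_le by metis
  qed
  have tail: "u k \<le> u L" if "L \<le> k" for k
    using that by (induction k rule: dec_induct) (use dec in \<open>auto intro: order_trans\<close>)
  have "u k \<le> Max (u ` {..L})" for k
  proof (cases "k \<le> L")
    case False
    then have "u k \<le> u L" by (intro tail) simp
    also have "u L \<le> Max (u ` {..L})" by (intro Max_ge) auto
    finally show ?thesis .
  qed (auto intro: Max_ge)
  then have "(\<Prod>i<k. real (r i)) powr s \<le> Max (u ` {..L}) * (\<Prod>i<k. real (m i))" for k
    using M0[of k] by (simp add: u_def M_def divide_le_eq)
  then show ?thesis by (rule that)
qed

text \<open>The digits whose cylinders fit into \<open>{a n..b n}\<close> form a block of length at
  least \<open>w/2\<close> times the base entry, so \<open>recode_expanding\<close> applies for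
  every \<open>s < 1\<close>. Only eventual constraints matter, which leaves finitely many positions
  free to be frozen.\<close>

lemma hausdorff_dim_prescribed_orbit:
  fixes a b :: "nat \<Rightarrow> real"
  assumes q: "basic_sequence q" "infinite_in_limit q"
    and \<delta>: "0 < \<delta>" "\<And>n. \<delta> \<le> a n" "\<And>n. b n \<le> 1 - \<delta>"
    and w: "0 < w" "\<And>n. a n + w \<le> b n"
    and E: "E \<subseteq> {0..<1}"
      "\<And>x N. x \<in> {0..<1} \<Longrightarrow> (\<And>n. N \<le> n \<Longrightarrow> cantor_orbit q x n \<in> {a n..b n}) \<Longrightarrow> x \<in> E"
  shows "hausdorff_dim E = 1"
proof -
  \<comment> \<open>The tail at time \<open>n\<close> starts with a digit in base
    \<open>q (Suc n)\<close>.\<close>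
  define r where "r n = q (Suc n)" for n
  have r2: "2 \<le> r n" for n using q(1) by (simp add: r_def basic_sequence_def)
  have r0: "0 < real (r n)" for n using r2[of n] by simp
  have r_top: "filterlim r at_top sequentially"
    using q(2) filterlim_sequentially_Suc[of q at_top] unfolding r_def infinite_in_limit_def by simp
  \<comment> \<open>Rounding both endpoints inwards loses fewer than 2 digits;
    \<open>4 \<le> w * r n\<close> ensures that at least half of \<open>w * r n\<close>
    remains.\<close>
  have "eventually (\<lambda>n. nat \<lceil>4 / w\<rceil> \<le> r n) sequentially"
    using r_top unfolding filterlim_at_top by blast
  then obtain N where N: "\<And>n. N \<le> n \<Longrightarrow> nat \<lceil>4 / w\<rceil> \<le> r n"
    by (auto simp: eventually_sequentially)
  have rw: "4 \<le> w * real (r n)" if "N \<le> n" for n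
  proof -
    have "4 / w \<le> real (r n)" using N[OF that] by linarith
    then show ?thesis using w(1) by (simp add: field_simps)
  qed
  have \<delta>': "\<delta> \<le> 1/2" using \<delta>(2)[of 0] \<delta>(3)[of 0] w(1) w(2)[of 0] by linarith
  \<comment> \<open>Before \<open>N\<close> the only digit is 0. Afterwards the digits run from the
    rounded-up left end to one below the rounded-down right end, so whole cylinders lie in
    \<open>{a n..b n}\<close>.\<close>
  define d where "d n = (if n < N then 0 else nat \<lceil>a n * real (r n)\<rceil>)" for n
  define m where "m n = (if n < N then 1 else nat \<lfloor>b n * real (r n)\<rfloor> - d n)" for n
  have dm: "a n * real (r n) \<le> real (d n) \<and> real (d n + m n) \<le> b n * real (r n) \<and>
      w/2 * real (r n) \<le> real (m n)" if n: "N \<le> n" for n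
  proof -
    have a0: "0 \<le> a n * real (r n)" using \<delta>(1) \<delta>(2)[of n] by simp
    have ab: "a n * real (r n) + w * real (r n) \<le> b n * real (r n)"
      using mult_right_mono[OF w(2)[of n], of "real (r n)"] by (simp add: algebra_simps)
    have d: "real (d n) = of_int \<lceil>a n * real (r n)\<rceil>" using a0 n by (simp add: d_def)
    have b0: "0 \<le> b n * real (r n)" using ab a0 rw[OF n] by linarith
    define f where "f = nat \<lfloor>b n * real (r n)\<rfloor>"
    have f: "real f = of_int \<lfloor>b n * real (r n)\<rfloor>" using b0 by (simp add: f_def)
    have d2: "a n * real (r n) \<le> real (d n)" "real (d n) < a n * real (r n) + 1"
      unfolding d by linarith+
    have f2: "real f \<le> b n * real (r n)" "b n * real (r n) < real f + 1"
      unfolding f by linarith+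
    have "real (d n) \<le> real f" using d2 f2 ab rw[OF n] by linarith
    then have "real (m n) = real f - real (d n)" using n by (simp add: m_def f_def)
    then show ?thesis using d2 f2 ab rw[OF n] by auto
  qed
  have m0: "0 < m n" for n
  proof (cases "n < N")
    case False
    then show ?thesis using dm[of n] rw[of n] by auto
  qed (simp add: m_def)
  have low: "\<delta> * real (r n) \<le> real (d n)" if "N \<le> n" for n
    using dm[OF that] mult_right_mono[OF \<delta>(2)[of n], of "real (r n)"] by linarith
  have high: "real (d n + m n) \<le> (1 - \<delta>) * real (r n)" if "N \<le> n" for n
    using dm[OF that] mult_right_mono[OF \<delta>(3)[of n], of "real (r n)"] by linarith
  have fit: "d n + m n \<le> r n" for n
  proof (cases "n < N")
    case False
    then have "real (d n + m n) \<le> (1 - \<delta>) * real (r n)" by (intro high) simp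
    also have "\<dots> \<le> real (r n)" using \<delta>(1) by (simp add: algebra_simps)
    finally show ?thesis by linarith
  qed (use r2[of n] in \<open>simp add: d_def m_def\<close>)
  define \<psi> where "\<psi> t = series_tail r (recode m d t) 0" for t
  have \<psi>E: "\<psi> t \<in> E" if t: "t \<in> {0..<1}" for t
  proof -
    define X where "X = series_tail r (recode m d t)"
    have dig: "cantor_digit m t n < m n" for n using t m0 by (rule cantor_digit_less)
    have D: "recode m d t n < r n" for n
      using dig[of n] fit[of n] by (simp add: recode_def)
    have X01: "0 \<le> X n" "X n \<le> 1" for n
      unfolding X_def using series_tail_nonneg series_tail_le_1 D by blast+
    have X_rec: "X n = (real (recode m d t n) + X (Suc n)) / real (r n)" for n
      unfolding X_def by (rule series_tail_rec) (rule D)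
    have Xab: "X n \<in> {a n..b n}" if n: "N \<le> n" for n
    proof -
      have "real (recode m d t n) + 1 \<le> real (d n + m n)" "real (d n) \<le> real (recode m d t n)"
        using dig[of n] by (auto simp: recode_def)
      then have "a n * real (r n) \<le> real (recode m d t n) + X (Suc n)"
        "real (recode m d t n) + X (Suc n) \<le> b n * real (r n)"
        using dm[OF n] X01[of "Suc n"] by linarith+
      then show ?thesis unfolding X_rec[of n] using r0[of n] by (simp add: field_simps)
    qed
    \<comment> \<open>At frozen positions the digit 0 gives a tail of at most 1/2; later tails are
      at most \<open>1 - \<delta>\<close>.\<close>
    have X1: "X n < 1" for n
    proof (cases "n < N")
      case True
      then have "recode m d t n = 0" using dig[of n] by (simp add: recode_def d_def m_def)
      then have "X n = X (Suc n) / real (r n)" using X_rec[of n] by simp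
      also have "\<dots> < 1" using X01[of "Suc n"] r2[of n] by simp
      finally show ?thesis .
    next
      case False
      then show ?thesis using Xab[of n] \<delta>(1) \<delta>(3)[of n] by auto
    qed
    have prod_q: "(\<Prod>i=1..n. q i) = (\<Prod>i<n. r i)" for n
      unfolding r_def by (induction n) (simp_all add: mult.commute)
    have "frac (real (\<Prod>i<n. r i) * X 0) = X n" for n
      unfolding X_def by (rule frac_prod_times_series_tail) (use D X1 in \<open>auto simp: X_def\<close>)
    then have orbit: "cantor_orbit q (\<psi> t) n = X n" for n
      unfolding cantor_orbit_def cantor_T_def prod_q by (simp add: \<psi>_def X_def)
    show ?thesis
      using X01[of 0] X1[of 0] Xab by (intro E(2)[of _ N]) (auto simp: orbit, auto simp: \<psi>_def X_def)
  qed
  show ?thesis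
  proof (rule hausdorff_dim_eq_1I[OF E(1)])
    show "E \<noteq> {}" using \<psi>E[of 0] by auto
    fix s :: real assume s: "0 < s" "s < 1"
    obtain C where C: "\<And>k. (\<Prod>i<k. real (r i)) powr s \<le> C * (\<Prod>i<k. real (m i))"
    proof (rule prod_powr_bounded[of r m "w/2" N s])
      show "0 < r n" for n using r0[of n] by simp
    qed (use r_top m0 w(1) dm s in auto)
    show "hausdorff_measure s E \<noteq> 0"
    proof (rule hausdorff_measure_pos_of_expanding[OF s(1)])
      show "\<psi> ` {0..<1} \<subseteq> E" using \<psi>E by auto
      fix t t' :: real assume "t \<in> {0..<1}" "t' \<in> {0..<1}"
      then show "\<bar>t - t'\<bar> \<le> 2 * C / (2 * \<delta> * (w/2)) powr s * dist (\<psi> t) (\<psi> t') powr s"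
        unfolding \<psi>_def dist_real_def
        using m0 fit r2 s \<delta>(1) \<delta>' low high w(1) dm C
        by (intro recode_expanding[where N = N]) (auto simp: m_def)
    qed
  qed
qed

section \<open>Times of prescribed density\<close>

lemma card_floor_jumps:
  fixes p \<theta> :: real
  assumes p: "0 \<le> p" "p \<le> 1"
  shows "int (card {i. i \<le> n \<and> \<lfloor>real i * p + \<theta>\<rfloor> < \<lfloor>real (Suc i) * p + \<theta>\<rfloor>})
    = \<lfloor>real (Suc n) * p + \<theta>\<rfloor> - \<lfloor>\<theta>\<rfloor>"
proof -
  define J where "J i \<longleftrightarrow> \<lfloor>real i * p + \<theta>\<rfloor> < \<lfloor>real (Suc i) * p + \<theta>\<rfloor>" for i
  \<comment> \<open>A step of length at most 1 raises the floor by 0 or 1, so counting jumps is a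
    telescoping sum.\<close>
  have step: "\<lfloor>real (Suc i) * p + \<theta>\<rfloor> = \<lfloor>real i * p + \<theta>\<rfloor> + (if J i then 1 else 0)" for i
  proof -
    have "real (Suc i) * p + \<theta> = (real i * p + \<theta>) + p" by (simp add: algebra_simps)
    then show ?thesis unfolding J_def using p by (simp del: of_nat_Suc) linarith
  qed
  have "int (card {i. i \<le> n \<and> J i}) = \<lfloor>real (Suc n) * p + \<theta>\<rfloor> - \<lfloor>\<theta>\<rfloor>"
  proof (induction n)
    case 0
    have "{i. i \<le> 0 \<and> J i} = (if J 0 then {0} else {})" by auto
    then show ?case using step[of 0] by simp
  next
    case (Suc n)
    have "{i. i \<le> Suc n \<and> J i} = (if J (Suc n) then insert (Suc n) {i. i \<le> n \<and> J i} else {i. i \<le> n \<and> J i})"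
      by (auto simp: le_Suc_eq)
    then show ?case using Suc step[of "Suc n"] by simp
  qed
  then show ?thesis by (simp add: J_def)
qed

text \<open>The number of jumps up to \<open>n\<close> is \<open>n * p\<close> up to a bounded
  error, and the first \<open>N\<close> times alter the count by at most \<open>N\<close>; both
  vanish after division by \<open>n\<close>.\<close>

lemma visits_frequency:
  fixes p \<theta> :: real
  assumes p: "0 \<le> p" "p \<le> 1"
    and vis: "\<And>i. N \<le> i \<Longrightarrow>
      \<omega> i \<in> I \<longleftrightarrow> \<lfloor>real i * p + \<theta>\<rfloor> < \<lfloor>real (Suc i) * p + \<theta>\<rfloor>"
  shows "(\<lambda>n. real (visits n I \<omega>) / real n) \<longlonglongrightarrow> p"
proof -
  define S where "S n = {i. i \<le> n \<and> \<lfloor>real i * p + \<theta>\<rfloor> < \<lfloor>real (Suc i) * p + \<theta>\<rfloor>}" for n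
  define V where "V n = {i. i \<le> n \<and> \<omega> i \<in> I}" for n
  have fin: "finite (S n)" "finite (V n)" for n by (auto simp: S_def V_def)
  have bound: "\<bar>real (visits n I \<omega>) - real n * p\<bar> \<le> real N + 3" for n
  proof -
    have "V n \<subseteq> S n \<union> {..<N}" "S n \<subseteq> V n \<union> {..<N}"
      using vis by (auto simp: V_def S_def not_le[symmetric])
    then have "card (V n) \<le> card (S n \<union> {..<N})" "card (S n) \<le> card (V n \<union> {..<N})"
      using fin by (auto intro!: card_mono)
    then have "card (V n) \<le> card (S n) + N" "card (S n) \<le> card (V n) + N"
      using card_Un_le[of "S n" "{..<N}"] card_Un_le[of "V n" "{..<N}"] by auto
    then have VS: "\<bar>real (card (V n)) - real (card (S n))\<bar> \<le> real N" by linarith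
    have "int (card (S n)) = \<lfloor>real (Suc n) * p + \<theta>\<rfloor> - \<lfloor>\<theta>\<rfloor>"
      unfolding S_def by (rule card_floor_jumps[OF p])
    then have "real (card (S n)) = of_int (\<lfloor>real (Suc n) * p + \<theta>\<rfloor> - \<lfloor>\<theta>\<rfloor>)"
      by (metis of_int_of_nat_eq)
    moreover have "real (Suc n) * p = real n * p + p" by (simp add: algebra_simps)
    ultimately have "\<bar>real (card (S n)) - real n * p\<bar> \<le> 3" using p by linarith
    then show ?thesis using VS by (simp add: visits_def V_def)
  qed
  have "(\<lambda>n. real (visits n I \<omega>) / real n - p) \<longlonglongrightarrow> 0"
  proof (rule Lim_null_comparison)
    show "(\<lambda>n. (real N + 3) / real n) \<longlonglongrightarrow> 0" by (rule lim_const_over_n)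
    show "\<forall>\<^sub>F n in sequentially. norm (real (visits n I \<omega>) / real n - p) \<le> (real N + 3) / real n"
      using eventually_gt_at_top[of 0]
    proof eventually_elim
      case (elim n)
      then have "real (visits n I \<omega>) / real n - p = (real (visits n I \<omega>) - real n * p) / real n"
        by (simp add: field_simps)
      then show ?case using bound[of n] by (simp add: divide_right_mono)
    qed
  qed
  then show ?thesis by (rule LIM_zero_cancel)
qed

text \<open>Both points would lie in a half-open interval of length \<open>p\<close>, but an integer and a half-integer
  differ by at least \<open>1/2\<close>.\<close>

lemma floor_jumps_disjoint:
  fixes x p :: real
  assumes "p \<le> 1/2" "\<lfloor>x\<rfloor> < \<lfloor>x + p\<rfloor>"
  shows "\<not> \<lfloor>x + 1/2\<rfloor> < \<lfloor>x + p + 1/2\<rfloor>"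
proof
  assume half: "\<lfloor>x + 1/2\<rfloor> < \<lfloor>x + p + 1/2\<rfloor>"
  define y z where "y = \<lfloor>x + p\<rfloor>" and "z = \<lfloor>x + p + 1/2\<rfloor>"
  have "x < of_int y" "of_int y \<le> x + p" using assms(2) unfolding y_def by linarith+
  moreover have "x + 1/2 < of_int z" "of_int z \<le> x + p + 1/2"
    using half unfolding z_def by linarith+
  \<comment> \<open>Because \<open>p\<close> is at most 1/2, the integer \<open>z\<close> would lie
    strictly between \<open>y\<close> and \<open>y + 1\<close>.\<close>
  ultimately have "real_of_int y < real_of_int z" "real_of_int z < real_of_int (y + 1)"
    using assms(1) by (linarith, simp)
  then show False unfolding of_int_less_iff by simp
qed

section \<open>Choice of the target intervals\<close>

lemma nondegenerate_interval_subinterval: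
  assumes "nondegenerate_interval I" "I \<subseteq> {0..1}"
  obtains a b where "0 < a" "a < b" "b < 1" "{a..b} \<subseteq> I"
proof -
  obtain u v where uv: "u \<in> I" "v \<in> I" "u < v" and I: "is_interval I"
    using assms(1) by (auto simp: nondegenerate_interval_def)
  then have "{u..v} \<subseteq> I" by (meson atLeastAtMost_iff mem_is_interval_1_I subsetI)
  moreover have "0 \<le> u" "v \<le> 1" using uv assms(2) by auto
  ultimately show ?thesis using uv(3)
    \<comment> \<open>The middle third of \<open>{u..v}\<close> stays away from 0 and 1.\<close>
    by (intro that[of "(2 * u + v) / 3" "(u + 2 * v) / 3"]) (auto simp: subset_iff)
qed

text \<open>The frontier of a convex set is negligible. Passing to closures therefore costs no
  measure and makes the complement open.\<close>

lemma measure_closure_interval: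
  fixes I :: "real set"
  assumes "is_interval I" "bounded I"
  shows "closure I \<in> lmeasurable" "measure lebesgue (closure I) = measure lebesgue I"
proof -
  have neg: "negligible (frontier I)"
    using assms(1) by (intro negligible_convex_frontier is_interval_convex)
  show "closure I \<in> lmeasurable" using assms(2) by (simp add: lmeasurable_compact compact_closure)
  show "measure lebesgue (closure I) = measure lebesgue I"
    using assms neg by (intro measure_closure)
qed

text \<open>The closures of \<open>I\<close> and \<open>J\<close> have total measure below 1 and
  cannot cover the open unit interval; what they miss is open and nonempty.\<close>

lemma complement_subinterval:
  fixes I J :: "real set"
  assumes I: "is_interval I" "I \<subseteq> {0..1}" and J: "is_interval J" "J \<subseteq> {0..1}"
    and less: "measure lebesgue I + measure lebesgue J < 1"
  obtains a b where "0 < a" "a < b" "b < 1" "{a..b} \<inter> (I \<union> J) = {}"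
proof -
  have bd: "bounded I" "bounded J" using I J bounded_closed_interval bounded_subset by blast+
  note mI = measure_closure_interval[OF I(1) bd(1)] and mJ = measure_closure_interval[OF J(1) bd(2)]
  define G where "G = {0<..<1} - (closure I \<union> closure J)"
  have "open G" unfolding G_def by (intro open_Diff) auto
  have "G \<noteq> {}"
  proof
    assume "G = {}"
    then have "{0<..<1} \<subseteq> closure I \<union> closure J" by (auto simp: G_def)
    then have "measure lebesgue {0<..<1::real} \<le> measure lebesgue (closure I \<union> closure J)"
      using mI(1) mJ(1) by (intro measure_mono_fmeasurable) auto
    also have "\<dots> \<le> measure lebesgue (closure I) + measure lebesgue (closure J)"
      using mI(1) mJ(1) by (intro measure_Un_le) auto
    finally show False using less mI(2) mJ(2) by simp
  qed
  then obtain x where "x \<in> G" by blast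
  then obtain e where e: "0 < e" "cball x e \<subseteq> G"
    using \<open>open G\<close> by (meson open_contains_cball)
  then have sub: "{x..x + e} \<subseteq> G" by (auto simp: cball_eq_atLeastAtMost)
  then have "x \<in> G" "x + e \<in> G" using e(1) by auto
  moreover have "{x..x + e} \<inter> (I \<union> J) = {}"
    using sub closure_subset[of I] closure_subset[of J] by (auto simp: G_def)
  ultimately show ?thesis using e(1) by (intro that[of x "x + e"]) (auto simp: G_def)
qed

theorem mainTheorem4:
  fixes I J :: "real set" and f g :: "real \<Rightarrow> real" and q :: "nat \<Rightarrow> nat"
  assumes "nondegenerate_interval I" and "I \<subseteq> {0..1}"
    and "nondegenerate_interval J" and "J \<subseteq> {0..1}"
    and "I \<inter> J = {}"
    and "\<exists>x0\<in>{0..1/2}. f x0 = g x0"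
    and "measure lebesgue I + measure lebesgue J < 1"
    and "basic_sequence q" and "infinite_in_limit q"
  shows "hausdorff_dim {x \<in> {0..<1}.
           convergent (\<lambda>n. real (visits n I (cantor_orbit q x)) / real n) \<and>
           convergent (\<lambda>n. real (visits n J (cantor_orbit q x)) / real n) \<and>
           f (lim (\<lambda>n. real (visits n I (cantor_orbit q x)) / real n)) =
           g (lim (\<lambda>n. real (visits n J (cantor_orbit q x)) / real n))} = 1"
    (is "hausdorff_dim ?E = 1")
proof -
  obtain p where p: "0 \<le> p" "p \<le> 1/2" "f p = g p" using assms(6) by auto
  obtain a1 b1 where 1: "0 < a1" "a1 < b1" "b1 < 1" "{a1..b1} \<subseteq> I"
    using nondegenerate_interval_subinterval[OF assms(1,2)] .
  obtain a2 b2 where 2: "0 < a2" "a2 < b2" "b2 < 1" "{a2..b2} \<subseteq> J"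
    using nondegenerate_interval_subinterval[OF assms(3,4)] .
  have "is_interval I" "is_interval J" using assms(1,3) by (auto simp: nondegenerate_interval_def)
  then obtain a3 b3 where 3: "0 < a3" "a3 < b3" "b3 < 1" "{a3..b3} \<inter> (I \<union> J) = {}"
    using complement_subinterval[OF _ assms(2) _ assms(4,7)] by blast
  \<comment> \<open>The shifts 0 and 1/2 give the two disjoint kinds of times, each of density
    \<open>p\<close>.\<close>
  define K where "K \<theta> i \<longleftrightarrow> \<lfloor>real i * p + \<theta>\<rfloor> < \<lfloor>real (Suc i) * p + \<theta>\<rfloor>" for \<theta> i
  have disj: "\<not> K (1/2) i" if "K 0 i" for i
    using floor_jumps_disjoint[OF p(2), of "real i * p"] that by (simp add: K_def algebra_simps)
  define a where "a i = (if K 0 i then a1 else if K (1/2) i then a2 else a3)" for i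
  define b where "b i = (if K 0 i then b1 else if K (1/2) i then b2 else b3)" for i
  \<comment> \<open>Only three target intervals occur, so the margin and the width are uniform in
    time.\<close>
  define \<delta> where "\<delta> = Min {a1, a2, a3, 1 - b1, 1 - b2, 1 - b3}"
  define w where "w = Min {b1 - a1, b2 - a2, b3 - a3}"
  show ?thesis
  proof (rule hausdorff_dim_prescribed_orbit[OF assms(8,9), of \<delta> a b w])
    show "0 < \<delta>" "0 < w" using 1 2 3 by (auto simp: \<delta>_def w_def)
    have "\<delta> \<le> a1" "\<delta> \<le> a2" "\<delta> \<le> a3" "\<delta> \<le> 1 - b1" "\<delta> \<le> 1 - b2" "\<delta> \<le> 1 - b3"
      unfolding \<delta>_def by (rule Min_le; simp)+
    then show "\<delta> \<le> a n" "b n \<le> 1 - \<delta>" for n by (auto simp: a_def b_def)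
    have "w \<le> b1 - a1" "w \<le> b2 - a2" "w \<le> b3 - a3"
      unfolding w_def by (rule Min_le; simp)+
    then show "a n + w \<le> b n" for n by (auto simp: a_def b_def)
    show "?E \<subseteq> {0..<1}" by blast
    fix x :: real and N assume x: "x \<in> {0..<1}"
      and orb: "\<And>n. N \<le> n \<Longrightarrow> cantor_orbit q x n \<in> {a n..b n}"
    \<comment> \<open>The converse directions hold because \<open>I\<close> and \<open>J\<close> are
      disjoint and the third interval avoids both.\<close>
    have "cantor_orbit q x n \<in> I \<longleftrightarrow> K 0 n" "cantor_orbit q x n \<in> J \<longleftrightarrow> K (1/2) n" if "N \<le> n" for n
      using orb[OF that] disj[of n] 1(4) 2(4) 3(4) assms(5)
      by (auto simp: a_def b_def split: if_splits)
    then have lims: "(\<lambda>n. real (visits n I (cantor_orbit q x)) / real n) \<longlonglongrightarrow> p"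
      "(\<lambda>n. real (visits n J (cantor_orbit q x)) / real n) \<longlonglongrightarrow> p"
      using p visits_frequency[of p N "cantor_orbit q x" I 0]
        visits_frequency[of p N "cantor_orbit q x" J "1/2"] by (auto simp: K_def)
    then show "x \<in> ?E" using x p(3) by (auto simp: convergentI limI)
  qed
qed

end
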